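(* For each $\Gamma\in N(n,d)$, define $\zeta_\Gamma\in\mathrm{S}^-_F(n,d)=\mathrm{Hom}_{\mathbf{S}_d}(F[B(n,d)],F[B(n,d)]\otimes\mathrm{sgn})$ by $$\zeta_\Gamma f(S)=\sum_{\{T\in B(n,d)\mid\Gamma_{S,T}=\Gamma\}}\epsilon(\gamma_{S,T})\,f(T).$$ Then the set $\{\zeta_\Gamma\mid\Gamma\in N(n,d)\}$ is a basis of $\mathrm{S}^-_F(n,d)$.
   Context: Let $F$ be a field of characteristic different from $2$, and $n,d$ positive integers; $[n]=\{1,\dots,n\}$, $[n']=\{1',\dots,n'\}$. $B(n,d)$ is the set of $n$-tuples $S=(S_1,\dots,S_n)$ of pairwise disjoint (possibly empty) sets with union $[d]$; the symmetric group $\mathbf{S}_d$ acts on the right by $S\cdot w=(w^{-1}(S_1),\dots,w^{-1}(S_n))$. $F[B(n,d)]$ is the space of functions $B(n,d)\to F$ with action $(\rho(w)f)(S)=f(S\cdot w)$; it is isomorphic to $(F^n)^{\otimes d}$ with $\mathbf{S}_d$ permuting tensor factors. $\mathrm{sgn}$ is the sign character, and $\mathrm{S}^-_F(n,d)=\mathrm{Hom}_{\mathbf{S}_d}((F^n)^{\otimes d},(F^n)^{\otimes d}\otimes\mathrm{sgn})$ is identified with the space of linear endomorphisms $A$ of $F[B(n,d)]$ with $A\rho(w)=\mathrm{sgn}(w)\rho(w)A$ for all $w\in\mathbf{S}_d$. $N(n,d)$ is the set of simple bipartite graphs with vertex set $[n']\coprod[n]$ and $d$ edges (each edge joins a vertex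 of $[n']$ to a vertex of $[n]$, no multiple edges). A labelling of a bipartite multigraph $\Gamma$ on $[n']\coprod[n]$ with $d$ edges is a function $l:[d]\to[n']\times[n]$ such that $|l^{-1}(i',j)|$ is the number of edges joining $i'$ and $j$. For $S,T\in B(n,d)$, $\Gamma_{S,T}$ is the bipartite multigraph with $|S_j\cap T_i|$ edges between $i'$ and $j$; $l_{S,T}$ is its labelling with $l_{S,T}(s)=(i',j)$ when $s\in S_j\cap T_i$; $\gamma_{S,T}$ denotes $\Gamma_{S,T}$ with this labelling. The standard labelling $l_0$ of $\Gamma\in N(n,d)$ labels the edges $1,\dots,d$ in increasing lexicographic order, where $(i',j)<(r',s)$ if $i<r$, or $i=r$ and $j<s$. The sign $\epsilon(\Gamma,l)$ of a labelling $l$ of $\Gamma\in N(n,d)$ is the sign of the permutation of $[d]$ sending the $l_0$-label of each edge to its $l$-label. For $\Gamma_{S,T}\in N(n,d)$, $\epsilon(\gamma_{S,T})=\epsilon(\Gamma_{S,T},l_{S,T})$. *)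

theory Defs
  imports Complex_Main "HOL-Combinatorics.Permutations" "HOL-Library.Disjoint_Sets"
    "HOL-Library.Function_Algebras" "HOL-Library.Product_Lexorder"
begin

text \<open>
  An \<open>n\<close>-tuple of sets \<open>(S\<^sub>1, \<dots>, S\<^sub>n)\<close> is a function on \<open>nat\<close> that is padded by the empty set at
  all indices outside \<open>{1..n}\<close>.
\<close>

type_synonym tuple = "nat \<Rightarrow> nat set"

definition B :: "nat \<Rightarrow> nat \<Rightarrow> tuple set" where
  "B n d = {S. disjoint_family_on S {1..n} \<and> (\<Union>i\<in>{1..n}. S i) = {1..d}
             \<and> (\<forall>i. i \<notin> {1..n} \<longrightarrow> S i = {})}"

definition act :: "tuple \<Rightarrow> (nat \<Rightarrow> nat) \<Rightarrow> tuple" where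
  "act S w = (\<lambda>i. inv w ` S i)"

text \<open>
  The space \<open>F[B(n,d)]\<close> is realised as the space of functions on all tuples that vanish outside
  \<open>B n d\<close>. Addition of functions is the pointwise one of \<open>Function_Algebras\<close>.
\<close>

definition FB :: "nat \<Rightarrow> nat \<Rightarrow> (tuple \<Rightarrow> 'a::field) set" where
  "FB n d = {f. \<forall>S. S \<notin> B n d \<longrightarrow> f S = 0}"

definition fscale :: "'a::field \<Rightarrow> ('b \<Rightarrow> 'a) \<Rightarrow> 'b \<Rightarrow> 'a" where
  "fscale c f = (\<lambda>x. c * f x)"

definition \<rho> :: "(nat \<Rightarrow> nat) \<Rightarrow> (tuple \<Rightarrow> 'a::field) \<Rightarrow> tuple \<Rightarrow> 'a" where
  "\<rho> w f = (\<lambda>S. f (act S w))"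

type_synonym 'a oper = "(tuple \<Rightarrow> 'a) \<Rightarrow> tuple \<Rightarrow> 'a"

definition opscale :: "'a::field \<Rightarrow> 'a oper \<Rightarrow> 'a oper" where
  "opscale c A = (\<lambda>f. fscale c (A f))"

global_interpretation oper: vector_space "opscale :: 'a::field \<Rightarrow> 'a oper \<Rightarrow> 'a oper"
  by standard (auto simp: opscale_def fscale_def fun_eq_iff algebra_simps)

text \<open>
  An endomorphism of \<open>F[B(n,d)]\<close> is a function linear on \<open>FB n d\<close>, set to \<open>0\<close> at arguments outside
  \<open>FB n d\<close>, so that distinct members of \<open>Sminus n d\<close> differ as maps \<open>F[B(n,d)] \<rightarrow> F[B(n,d)]\<close>.
\<close>

definition End_FB :: "nat \<Rightarrow> nat \<Rightarrow> 'a::field oper set" where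
  "End_FB n d = {A. (\<forall>f\<in>FB n d. A f \<in> FB n d)
     \<and> (\<forall>f\<in>FB n d. \<forall>g\<in>FB n d. A (f + g) = A f + A g)
     \<and> (\<forall>c. \<forall>f\<in>FB n d. A (fscale c f) = fscale c (A f))
     \<and> (\<forall>f. f \<notin> FB n d \<longrightarrow> A f = 0)}"

definition Sminus :: "nat \<Rightarrow> nat \<Rightarrow> 'a::field oper set" where
  "Sminus n d = {A \<in> End_FB n d. \<forall>w. w permutes {1..d} \<longrightarrow>
     (\<forall>f\<in>FB n d. A (\<rho> w f) = fscale (of_int (sign w)) (\<rho> w (A f)))}"

text \<open>
  A bipartite multigraph on \<open>[n'] \<Coprod> [n]\<close> is given by its edge multiplicities: \<open>G (i, j)\<close> is the
  number of edges joining \<open>i'\<close> and \<open>j\<close>.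
\<close>

type_synonym multigraph = "nat \<times> nat \<Rightarrow> nat"

definition N :: "nat \<Rightarrow> nat \<Rightarrow> multigraph set" where
  "N n d = {G. (\<forall>e. e \<notin> {1..n} \<times> {1..n} \<longrightarrow> G e = 0) \<and> (\<forall>e. G e \<le> 1)
             \<and> (\<Sum>e\<in>{1..n} \<times> {1..n}. G e) = d}"

definition labelling :: "nat \<Rightarrow> nat \<Rightarrow> multigraph \<Rightarrow> (nat \<Rightarrow> nat \<times> nat) \<Rightarrow> bool" where
  "labelling n d G l \<longleftrightarrow> l ` {1..d} \<subseteq> {1..n} \<times> {1..n} \<and>
     (\<forall>e\<in>{1..n} \<times> {1..n}. card {s\<in>{1..d}. l s = e} = G e)"

definition \<Gamma> :: "tuple \<Rightarrow> tuple \<Rightarrow> multigraph" where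
  "\<Gamma> S T = (\<lambda>(i, j). card (S j \<inter> T i))"

definition lab :: "tuple \<Rightarrow> tuple \<Rightarrow> nat \<Rightarrow> nat \<times> nat" where
  "lab S T s = (THE i. s \<in> T i, THE j. s \<in> S j)"

definition std_lab :: "multigraph \<Rightarrow> nat \<Rightarrow> nat \<times> nat" where
  "std_lab G s = sorted_list_of_set {e. G e \<noteq> 0} ! (s - 1)"
  \<comment> \<open>the order on pairs is the lexicographic one of \<open>Product_Lexorder\<close>\<close>

definition \<epsilon> :: "nat \<Rightarrow> multigraph \<Rightarrow> (nat \<Rightarrow> nat \<times> nat) \<Rightarrow> int" where
  "\<epsilon> d G l = sign_on {1..d} (inv_into {1..d} l \<circ> std_lab G)"
  \<comment> \<open>\<open>s\<close> is the standard label of the edge \<open>std_lab G s\<close> and is sent to the \<open>l\<close>-label of that edge\<close>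

definition \<zeta> :: "nat \<Rightarrow> nat \<Rightarrow> multigraph \<Rightarrow> 'a::field oper" where
  "\<zeta> n d G = (\<lambda>f S. if f \<in> FB n d \<and> S \<in> B n d
     then \<Sum>T\<in>{T \<in> B n d. \<Gamma> S T = G}. of_int (\<epsilon> d (\<Gamma> S T) (lab S T)) * f T else 0)"

lemma B_ex1:
  assumes "S \<in> B n d" "s \<in> {1..d}"
  shows "\<exists>!i. s \<in> S i" "(THE i. s \<in> S i) \<in> {1..n}" "s \<in> S i \<longleftrightarrow> i = (THE i. s \<in> S i)"
proof -
  from assms obtain k where k: "k \<in> {1..n}" "s \<in> S k" unfolding B_def by blast
  have u: "j = k" if "s \<in> S j" for j
  proof (rule ccontr)
    assume "j \<noteq> k"
    moreover have "j \<in> {1..n}" using assms that by (auto simp: B_def)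
    ultimately have "S j \<inter> S k = {}" using assms k by (auto simp: B_def disjoint_family_on_def)
    with that k show False by blast
  qed
  show "\<exists>!i. s \<in> S i" using k u by blast
  have t: "(THE i. s \<in> S i) = k" using k(2) u by (rule the_equality)
  show "(THE i. s \<in> S i) \<in> {1..n}" unfolding t by (rule k(1))
  show "s \<in> S i \<longleftrightarrow> i = (THE i. s \<in> S i)" unfolding t using k u by blast
qed

lemma labelling_lab:
  assumes "S \<in> B n d" "T \<in> B n d"
  shows "labelling n d (\<Gamma> S T) (lab S T)"
proof -
  have c: "{s\<in>{1..d}. lab S T s = (i, j)} = S j \<inter> T i" if "i \<in> {1..n}" "j \<in> {1..n}" for i j
  proof -
    have "S j \<subseteq> {1..d}" using assms that by (auto simp: B_def)
    moreover have "lab S T s = (i, j) \<longleftrightarrow> s \<in> S j \<and> s \<in> T i" if "s \<in> {1..d}" for s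
      unfolding lab_def prod.inject
      using B_ex1(3)[OF assms(1) that, of j] B_ex1(3)[OF assms(2) that, of i] by metis
    ultimately show ?thesis by blast
  qed
  have "lab S T s \<in> {1..n} \<times> {1..n}" if "s \<in> {1..d}" for s
    unfolding lab_def using B_ex1(2)[OF assms(1) that] B_ex1(2)[OF assms(2) that]
    by (rule SigmaI[rotated])
  then have "lab S T ` {1..d} \<subseteq> {1..n} \<times> {1..n}" by (rule image_subsetI)
  then show ?thesis
    using c unfolding labelling_def \<Gamma>_def by (auto simp only: split_beta fst_conv snd_conv)
qed

lemma std_lab_N:
  assumes "G \<in> N n d"
  shows "bij_betw (std_lab G) {1..d} {e. G e \<noteq> 0}" "strict_mono_on {1..d} (std_lab G)"
    "labelling n d G (std_lab G)"
proof -
  let ?E = "{e. G e \<noteq> 0}"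
  have sub: "?E \<subseteq> {1..n} \<times> {1..n}"
    using assms unfolding N_def mem_Collect_eq subset_iff by metis
  then have fin: "finite ?E" by (rule finite_subset) simp
  have le: "G e \<le> 1" for e using assms unfolding N_def by blast
  have one: "G e = 1" if "e \<in> ?E" for e
    using le[of e] that by simp
  have "d = (\<Sum>e\<in>{1..n} \<times> {1..n}. G e)" using assms unfolding N_def by blast
  also have "\<dots> = sum G ?E" by (rule sum.mono_neutral_right[OF _ sub]) auto
  also have "\<dots> = sum (\<lambda>_. 1) ?E" by (rule sum.cong[OF refl]) (rule one)
  finally have card: "card ?E = d" by simp
  then have len: "length (sorted_list_of_set ?E) = d" by simp
  have nth: "bij_betw ((!) (sorted_list_of_set ?E)) {..<d} ?E"
    by (rule bij_betw_nth) (use fin len in auto)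
  have "bij_betw (\<lambda>s. s - 1) {1..d} {..<d}"
    by (rule bij_betwI[where g = Suc]) auto
  from bij_betw_trans[OF this nth] show b: "bij_betw (std_lab G) {1..d} ?E"
    by (simp add: std_lab_def[abs_def] comp_def)
  show "strict_mono_on {1..d} (std_lab G)"
  proof (rule strict_mono_onI)
    fix r s assume "r \<in> {1..d}" "s \<in> {1..d}" "r < s"
    then show "std_lab G r < std_lab G s"
      unfolding std_lab_def
      using sorted_wrt_nth_less[OF strict_sorted_list_of_set[of ?E], of "r - 1" "s - 1"] len
      by simp
  qed
  note surj = bij_betw_imp_surj_on[OF b] and inj = bij_betw_imp_inj_on[OF b]
  have c: "card {s\<in>{1..d}. std_lab G s = e} = G e" for e
  proof (cases "G e = 0")
    case False
    then have "e \<in> std_lab G ` {1..d}" using surj by simp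
    then obtain s where s: "s \<in> {1..d}" "e = std_lab G s" by (rule imageE)
    have "r = s" if "r \<in> {1..d}" "std_lab G r = e" for r
      by (rule inj_onD[OF inj]) (use s that in simp_all)
    then have "{s\<in>{1..d}. std_lab G s = e} = {s}" using s by blast
    then have "card {s\<in>{1..d}. std_lab G s = e} = 1" by simp
    then show ?thesis using one[of e] False by simp
  next
    case True
    then have "e \<notin> std_lab G ` {1..d}" using surj by simp
    then have "{s\<in>{1..d}. std_lab G s = e} = {}" by blast
    then have "card {s\<in>{1..d}. std_lab G s = e} = 0" by (simp only: card.empty)
    then show ?thesis using True by simp
  qed
  show "labelling n d G (std_lab G)"
    unfolding labelling_def surj using sub c by (intro conjI ballI)
qed

end

theory Submission
  imports Defs
begin

text \<open>
  An operator \<open>A\<close> on \<open>F[B(n,d)]\<close> is given by its matrix \<open>a(S,T)\<close>, the value at \<open>S\<close> of \<open>A\<close> applied to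
  the point mass at \<open>T\<close>. The twisted equivariance of \<open>A\<close> says that
  \<open>a(S \<cdot> w, T \<cdot> w) = sgn(w) a(S,T)\<close>, so \<open>a\<close> is determined by its values on representatives of the
  diagonal orbits on pairs \<open>(S,T)\<close>, and these orbits are indexed by the multigraphs \<open>\<Gamma>\<^sub>S\<^sub>,\<^sub>T\<close>.

  If \<open>\<Gamma>\<^sub>S\<^sub>,\<^sub>T\<close> has a multiple edge, some transposition fixes both \<open>S\<close> and \<open>T\<close>, whence
  \<open>a(S,T) = - a(S,T) = 0\<close> because the characteristic is not 2 (\<open>Sminus_matrix_eq_0\<close>). If \<open>\<Gamma>\<^sub>S\<^sub>,\<^sub>T = G\<close>
  is simple, the permutation whose sign is \<open>\<epsilon>\<close> carries \<open>(S,T)\<close> to the pair \<open>(S\<^sub>G,T\<^sub>G)\<close> read off from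
  the standard labelling of \<open>G\<close>, so \<open>a(S,T) = \<epsilon>(\<gamma>\<^sub>S\<^sub>,\<^sub>T) a(S\<^sub>G,T\<^sub>G)\<close> (\<open>Sminus_matrix_eq_std\<close>). Both
  statements together say \<open>A = \<Sum>\<^sub>G a(S\<^sub>G,T\<^sub>G) \<zeta>\<^sub>G\<close>.

  Conversely \<open>\<zeta>\<^sub>G\<close> is twisted equivariant since \<open>\<epsilon>\<close> picks up the factor \<open>sgn(w)\<close> under the diagonal
  action (\<open>eps_lab_act\<close>), and \<open>\<zeta>\<^sub>G\<close> has matrix entry 1 at \<open>(S\<^sub>G,T\<^sub>G)\<close> and 0 at \<open>(S\<^sub>H,T\<^sub>H)\<close> for \<open>H \<noteq> G\<close>;
  this gives injectivity and linear independence.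
\<close>

section \<open>Ordered set partitions and the action of permutations\<close>

lemma B_subset: "S \<in> B n d \<Longrightarrow> S i \<subseteq> {1..d}"
  unfolding B_def by (cases "i \<in> {1..n}") auto

lemma finite_B: "finite (B n d)"
proof (rule finite_subset)
  show "B n d \<subseteq> {S. \<forall>i. (i \<in> {1..n} \<longrightarrow> S i \<in> Pow {1..d}) \<and> (i \<notin> {1..n} \<longrightarrow> S i = {})}"
    using B_subset by (auto simp: B_def)
  show "finite {S. \<forall>i. (i \<in> {1..n} \<longrightarrow> S i \<in> Pow {1..d}) \<and> (i \<notin> {1..n} \<longrightarrow> S i = ({}::nat set))}"
    by (rule finite_set_of_finite_funs) auto
qed

lemma lab_eq_iff:
  assumes "S \<in> B n d" "T \<in> B n d" "s \<in> {1..d}"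
  shows "lab S T s = (i, j) \<longleftrightarrow> s \<in> T i \<and> s \<in> S j"
  unfolding lab_def prod.inject
  using B_ex1(3)[OF assms(1,3), of j] B_ex1(3)[OF assms(2,3), of i] by metis

lemma mem_act: "w permutes A \<Longrightarrow> s \<in> act S w i \<longleftrightarrow> w s \<in> S i"
  unfolding act_def using bij_image_Collect_eq[OF permutes_bij[OF permutes_inv], of w A "\<lambda>x. x \<in> S i"]
  by (simp add: permutes_inv_inv)

lemma act_mem_B:
  assumes "w permutes {1..d}" "S \<in> B n d"
  shows "act S w \<in> B n d"
proof -
  have "(\<Union>i\<in>{1..n}. act S w i) = inv w ` (\<Union>i\<in>{1..n}. S i)"
    unfolding act_def by blast
  also have "\<dots> = {1..d}"
    using assms(2) permutes_image[OF permutes_inv[OF assms(1)]] by (simp add: B_def)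
  finally have cover: "(\<Union>i\<in>{1..n}. act S w i) = {1..d}" .
  have "disjoint_family_on (act S w) {1..n}"
    unfolding disjoint_family_on_def
  proof (intro ballI impI)
    fix i j assume "i \<in> {1..n}" "j \<in> {1..n}" "i \<noteq> j"
    then have "S i \<inter> S j = {}" using assms(2) by (simp add: B_def disjoint_family_on_def)
    then show "act S w i \<inter> act S w j = {}"
      unfolding act_def image_Int[OF permutes_inj[OF permutes_inv[OF assms(1)]], symmetric] by simp
  qed
  moreover have "act S w i = {}" if "i \<notin> {1..n}" for i
    using assms(2) that unfolding act_def by (simp add: B_def)
  ultimately show ?thesis unfolding B_def mem_Collect_eq using cover by (intro conjI allI impI)
qed

lemma act_inverses:
  assumes "w permutes A"
  shows act_act_inv: "act (act S w) (inv w) = S" and act_inv_act: "act (act S (inv w)) w = S"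
  by (intro ext set_eqI;
    simp add: mem_act[OF assms] mem_act[OF permutes_inv[OF assms]] permutes_inverses[OF assms])+

lemma act_mem_B_iff:
  assumes "w permutes {1..d}"
  shows "act S w \<in> B n d \<longleftrightarrow> S \<in> B n d"
  using act_mem_B[OF assms, of S n] act_mem_B[OF permutes_inv[OF assms], of "act S w" n]
  unfolding act_act_inv[OF assms] by blast

lemma bij_betw_act: "w permutes {1..d} \<Longrightarrow> bij_betw (\<lambda>T. act T w) (B n d) (B n d)"
  by (rule bij_betwI[where g = "\<lambda>T. act T (inv w)"])
    (auto simp: act_mem_B_iff permutes_inv act_act_inv act_inv_act)

lemma Gamma_act:
  assumes "w permutes A"
  shows "\<Gamma> (act S w) (act T w) = \<Gamma> S T"
proof -
  have "act S w j \<inter> act T w i = inv w ` (S j \<inter> T i)" for i j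
    unfolding act_def by (rule image_Int[symmetric]) (use assms in \<open>auto intro: permutes_inj permutes_inv\<close>)
  then show ?thesis
    unfolding \<Gamma>_def
    by (simp add: card_image[OF permutes_inj_on[OF permutes_inv[OF assms]]])
qed

lemma lab_act:
  assumes "w permutes A"
  shows "lab (act S w) (act T w) = lab S T \<circ> w"
  by (rule ext) (simp add: lab_def mem_act[OF assms])

lemma Gamma_sum:
  assumes "S \<in> B n d" "T \<in> B n d"
  shows "(\<Sum>e\<in>{1..n} \<times> {1..n}. \<Gamma> S T e) = d"
proof -
  let ?E = "{1..n} \<times> {1..n}"
  note l = labelling_lab[OF assms, unfolded labelling_def]
  have "(\<Sum>e\<in>?E. \<Gamma> S T e) = (\<Sum>e\<in>?E. card {s \<in> {1..d}. lab S T s = e})"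
    by (rule sum.cong[OF refl]) (use l in metis)
  also have "\<dots> = (\<Sum>e\<in>?E. \<Sum>s\<in>{s \<in> {1..d}. lab S T s = e}. 1)" by simp
  also have "\<dots> = (\<Sum>s\<in>{1..d}. 1)"
    by (rule sum.group) (use l in auto)
  finally show ?thesis by simp
qed

lemma Gamma_mem_N_iff:
  assumes "S \<in> B n d" "T \<in> B n d"
  shows "\<Gamma> S T \<in> N n d \<longleftrightarrow> (\<forall>e. \<Gamma> S T e \<le> 1)"
proof -
  have "\<Gamma> S T e = 0" if "e \<notin> {1..n} \<times> {1..n}" for e
    using assms that by (cases e) (auto simp: \<Gamma>_def B_def)
  then show ?thesis using Gamma_sum[OF assms] unfolding N_def by blast
qed

section \<open>Labellings of simple graphs and their signs\<close>

lemma finite_N: "finite (N n d)"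
proof (rule finite_subset)
  show "N n d \<subseteq> {G. \<forall>e. (e \<in> {1..n} \<times> {1..n} \<longrightarrow> G e \<in> {..1}) \<and> (e \<notin> {1..n} \<times> {1..n} \<longrightarrow> G e = 0)}"
    by (auto simp: N_def)
  show "finite {G. \<forall>e. (e \<in> {1..n} \<times> {1..n} \<longrightarrow> G e \<in> {..1}) \<and>
      (e \<notin> {1..n} \<times> {1..n} \<longrightarrow> G e = (0::nat))}"
    by (rule finite_set_of_finite_funs) auto
qed

lemma N_outside: "G \<in> N n d \<Longrightarrow> e \<notin> {1..n} \<times> {1..n} \<Longrightarrow> G e = 0"
  unfolding N_def by blast

lemma labelling_bij_betw:
  assumes "G \<in> N n d" "labelling n d G l"
  shows "bij_betw l {1..d} {e. G e \<noteq> 0}"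
proof (rule bij_betw_imageI)
  have le: "G e \<le> 1" for e using assms(1) unfolding N_def by blast
  have im: "l s \<in> {1..n} \<times> {1..n}" if "s \<in> {1..d}" for s
    using assms(2) that by (auto simp: labelling_def)
  have c: "card {s \<in> {1..d}. l s = e} = G e" if "e \<in> {1..n} \<times> {1..n}" for e
    using assms(2) that unfolding labelling_def by blast
  show "inj_on l {1..d}"
  proof (rule inj_onI)
    fix s t assume st: "s \<in> {1..d}" "t \<in> {1..d}" "l s = l t"
    have "card {r \<in> {1..d}. l r = l s} \<le> Suc 0"
      using c[OF im[OF st(1)]] le[of "l s"] by simp
    then show "s = t" using st by (auto simp: card_le_Suc0_iff_eq)
  qed
  show "l ` {1..d} = {e. G e \<noteq> 0}"
  proof (intro equalityI subsetI)
    fix e assume "e \<in> l ` {1..d}"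
    then obtain s where s: "s \<in> {1..d}" "e = l s" by auto
    then have "{r \<in> {1..d}. l r = e} \<noteq> {}" by auto
    then have "card {r \<in> {1..d}. l r = e} \<noteq> 0" by (simp add: card_eq_0_iff)
    then show "e \<in> {e. G e \<noteq> 0}" unfolding c[OF im[OF s(1)], folded s(2)] by blast
  next
    fix e assume e: "e \<in> {e. G e \<noteq> 0}"
    have "e \<in> {1..n} \<times> {1..n}"
      by (rule ccontr) (use N_outside[OF assms(1), of e] e in blast)
    from c[OF this] have "card {r \<in> {1..d}. l r = e} \<noteq> 0" using e by simp
    then have "{r \<in> {1..d}. l r = e} \<noteq> {}" by (rule contrapos_nn) (simp only: card.empty)
    then show "e \<in> l ` {1..d}" by auto
  qed
qed

text \<open>
  The permutation that takes the standard label of each edge of \<open>G\<close> to its \<open>l\<close>-label, extended by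
  the identity outside \<open>{1..d}\<close>. Its sign is \<open>\<epsilon> d G l\<close>.
\<close>

definition label_perm :: "nat \<Rightarrow> multigraph \<Rightarrow> (nat \<Rightarrow> nat \<times> nat) \<Rightarrow> nat \<Rightarrow> nat" where
  "label_perm d G l = restrict_id (inv_into {1..d} l \<circ> std_lab G) {1..d}"

lemma eps_eq_sign: "\<epsilon> d G l = sign (label_perm d G l)"
  by (simp add: \<epsilon>_def label_perm_def sign_on_def)

lemma label_perm:
  assumes "G \<in> N n d" "labelling n d G l"
  shows label_perm_permutes: "label_perm d G l permutes {1..d}"
    and lab_label_perm: "s \<in> {1..d} \<Longrightarrow> l (label_perm d G l s) = std_lab G s"
proof -
  note bl = labelling_bij_betw[OF assms] and bs = std_lab_N(1)[OF assms(1)]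
  show "label_perm d G l permutes {1..d}"
    unfolding label_perm_def
    by (rule permutes_restrict_id[OF bij_betw_trans[OF bs bij_betw_inv_into[OF bl]]])
  show "l (label_perm d G l s) = std_lab G s" if "s \<in> {1..d}"
    using bij_betw_inv_into_right[OF bl] bij_betwE[OF bs] that by (simp add: label_perm_def)
qed

text \<open>
  Relabelling by \<open>w\<close>: an edge with \<open>l\<close>-label \<open>s\<close> has \<open>(l \<circ> w)\<close>-label \<open>w\<^sup>-\<^sup>1 s\<close>, so the permutation for \<open>l\<close> is
  \<open>w\<close> composed with the one for \<open>l \<circ> w\<close>.
\<close>

lemma eps_comp:
  assumes G: "G \<in> N n d" and l: "labelling n d G l" "labelling n d G (l \<circ> w)"
    and w: "w permutes {1..d}"
  shows "\<epsilon> d G (l \<circ> w) = sign w * \<epsilon> d G l"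
proof -
  let ?p = "label_perm d G l" and ?q = "label_perm d G (l \<circ> w)"
  note p = label_perm[OF G l(1)] and q = label_perm[OF G l(2)]
  have "?p s = (w \<circ> ?q) s" for s
  proof (cases "s \<in> {1..d}")
    case True
    have "?p s \<in> {1..d}" using True unfolding permutes_in_image[OF p(1)] .
    moreover have "w (?q s) \<in> {1..d}"
      using True unfolding permutes_in_image[OF w] permutes_in_image[OF q(1)] .
    moreover have "l (?p s) = l (w (?q s))"
      using p(2)[OF True] q(2)[OF True] unfolding comp_apply by (rule trans[OF _ sym])
    ultimately have "?p s = w (?q s)"
      by (rule inj_onD[OF bij_betw_imp_inj_on[OF labelling_bij_betw[OF G l(1)]], rotated])
    then show ?thesis unfolding comp_apply .
  next
    case False
    then show ?thesis
      unfolding comp_apply permutes_not_in[OF p(1) False] permutes_not_in[OF q(1) False]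
      by (rule permutes_not_in[OF w, symmetric])
  qed
  then have "?p = w \<circ> ?q" by (rule ext)
  moreover have "sign (w \<circ> ?q) = sign w * sign ?q"
    by (intro sign_compose permutes_imp_permutation[OF _ w] permutes_imp_permutation[OF _ q(1)]) simp_all
  ultimately have "sign ?q = sign w * sign ?p" by simp
  then show ?thesis unfolding eps_eq_sign .
qed

lemma eps_lab_act:
  assumes "S \<in> B n d" "T \<in> B n d" "\<Gamma> S T \<in> N n d" "w permutes {1..d}"
  shows "\<epsilon> d (\<Gamma> S T) (lab (act S w) (act T w)) = sign w * \<epsilon> d (\<Gamma> S T) (lab S T)"
  unfolding lab_act[OF assms(4)]
  by (rule eps_comp[OF assms(3) labelling_lab[OF assms(1,2)] _ assms(4)])
    (use labelling_lab[OF act_mem_B[OF assms(4,1)] act_mem_B[OF assms(4,2)]]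
      in \<open>simp only: lab_act[OF assms(4)] Gamma_act[OF assms(4)]\<close>)

text \<open>
  The pair \<open>(S\<^sub>G, T\<^sub>G)\<close> with \<open>\<Gamma> S\<^sub>G T\<^sub>G = G\<close> whose labelling is the standard one. The first tuple records
  the unprimed end points of the edges, the second one the primed end points.
\<close>

definition std_S :: "nat \<Rightarrow> multigraph \<Rightarrow> tuple" where
  "std_S d G = (\<lambda>j. {s \<in> {1..d}. snd (std_lab G s) = j})"

definition std_T :: "nat \<Rightarrow> multigraph \<Rightarrow> tuple" where
  "std_T d G = (\<lambda>i. {s \<in> {1..d}. fst (std_lab G s) = i})"

lemma std_pair_mem_B:
  assumes "G \<in> N n d"
  shows std_S_mem_B: "std_S d G \<in> B n d" and std_T_mem_B: "std_T d G \<in> B n d"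
proof -
  have e: "fst (std_lab G s) \<in> {1..n}" "snd (std_lab G s) \<in> {1..n}" if "s \<in> {1..d}" for s
  proof -
    have "std_lab G s \<in> {1..n} \<times> {1..n}"
      using std_lab_N(3)[OF assms] that unfolding labelling_def by blast
    then show "fst (std_lab G s) \<in> {1..n}" "snd (std_lab G s) \<in> {1..n}"
      unfolding mem_Times_iff by blast+
  qed
  show "std_S d G \<in> B n d"
    unfolding B_def std_S_def disjoint_family_on_def using e(2) by auto
  show "std_T d G \<in> B n d"
    unfolding B_def std_T_def disjoint_family_on_def using e(1) by auto
qed

lemma lab_std:
  assumes "G \<in> N n d" "s \<in> {1..d}"
  shows "lab (std_S d G) (std_T d G) s = std_lab G s"
proof -
  have "lab (std_S d G) (std_T d G) s = (fst (std_lab G s), snd (std_lab G s))"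
    using assms by (subst lab_eq_iff[OF std_pair_mem_B[OF assms(1)]]) (auto simp: std_S_def std_T_def)
  then show ?thesis by simp
qed

lemma Gamma_std:
  assumes "G \<in> N n d"
  shows "\<Gamma> (std_S d G) (std_T d G) = G"
proof
  fix e :: "nat \<times> nat"
  obtain i j where e: "e = (i, j)" by (cases e)
  have "std_S d G j \<inter> std_T d G i = {s \<in> {1..d}. std_lab G s = e}"
    unfolding std_S_def std_T_def e by (auto simp: prod_eq_iff)
  then have 1: "\<Gamma> (std_S d G) (std_T d G) e = card {s \<in> {1..d}. std_lab G s = e}"
    by (simp add: \<Gamma>_def e)
  show "\<Gamma> (std_S d G) (std_T d G) e = G e"
  proof (cases "e \<in> {1..n} \<times> {1..n}")
    case True
    then show ?thesis using 1 std_lab_N(3)[OF assms] unfolding labelling_def by metis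
  next
    case False
    then have "{s \<in> {1..d}. std_lab G s = e} = {}"
      using std_lab_N(3)[OF assms] unfolding labelling_def by blast
    then have "\<Gamma> (std_S d G) (std_T d G) e = 0" using 1 by (simp only: card.empty)
    then show ?thesis using N_outside[OF assms False] by simp
  qed
qed

lemma eps_std:
  assumes "G \<in> N n d"
  shows "\<epsilon> d G (lab (std_S d G) (std_T d G)) = 1"
proof -
  let ?l = "lab (std_S d G) (std_T d G)"
  have l: "labelling n d G ?l"
    using labelling_lab[OF std_pair_mem_B[OF assms]] by (simp add: Gamma_std[OF assms])
  note p = label_perm[OF assms l]
  have "label_perm d G ?l s = s" for s
  proof (cases "s \<in> {1..d}")
    case True
    then have "?l (label_perm d G ?l s) = ?l s" using p(2)[OF True] lab_std[OF assms True] by simp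
    moreover have "label_perm d G ?l s \<in> {1..d}" using True unfolding permutes_in_image[OF p(1)] .
    ultimately show ?thesis
      using True bij_betw_imp_inj_on[OF labelling_bij_betw[OF assms l]] by (simp add: inj_on_eq_iff)
  next
    case False
    then show ?thesis by (rule permutes_not_in[OF p(1)])
  qed
  then have "label_perm d G ?l = id" by auto
  then show ?thesis by (simp add: eps_eq_sign)
qed

text \<open>
  Every pair \<open>(S, T)\<close> with simple graph \<open>G\<close> lies in the orbit of \<open>(S\<^sub>G, T\<^sub>G)\<close>, and the permutation that
  moves it there is the one whose sign is \<open>\<epsilon>(\<gamma>\<^sub>S\<^sub>,\<^sub>T)\<close>.
\<close>

lemma act_label_perm:
  fixes S T :: tuple and d :: nat
  defines "w \<equiv> label_perm d (\<Gamma> S T) (lab S T)"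
  assumes "S \<in> B n d" "T \<in> B n d" "\<Gamma> S T \<in> N n d"
  shows "act S w = std_S d (\<Gamma> S T)" "act T w = std_T d (\<Gamma> S T)"
proof -
  note w = label_perm[OF assms(4) labelling_lab[OF assms(2,3)], folded w_def]
  have lb: "w s \<in> T (fst (std_lab (\<Gamma> S T) s)) \<and> w s \<in> S (snd (std_lab (\<Gamma> S T) s))"
    if "s \<in> {1..d}" for s
  proof -
    have "w s \<in> {1..d}" using that unfolding permutes_in_image[OF w(1)] .
    from lab_eq_iff[OF assms(2,3) this] show ?thesis
      unfolding w(2)[OF that] by (metis prod.collapse)
  qed
  have "act R w i = {s \<in> {1..d}. g s = i}"
    if R: "R \<in> B n d" and g: "\<And>s. s \<in> {1..d} \<Longrightarrow> w s \<in> R (g s)" for R g i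
  proof (rule set_eqI)
    fix s
    have d: "w s \<in> {1..d} \<longleftrightarrow> s \<in> {1..d}" by (rule permutes_in_image[OF w(1)])
    have "w s \<in> R i \<longleftrightarrow> g s = i" if s: "s \<in> {1..d}"
      using B_ex1(1)[OF R d[THEN iffD2, OF s]] g[OF s] by blast
    moreover have "s \<in> {1..d}" if "w s \<in> R i" using that d B_subset[OF R] by blast
    ultimately show "s \<in> act R w i \<longleftrightarrow> s \<in> {s \<in> {1..d}. g s = i}"
      unfolding mem_act[OF w(1)] by blast
  qed
  note orbit = this
  show "act S w = std_S d (\<Gamma> S T)"
    unfolding std_S_def by (intro ext orbit[OF assms(2)]) (use lb in blast)
  show "act T w = std_T d (\<Gamma> S T)"
    unfolding std_T_def by (intro ext orbit[OF assms(3)]) (use lb in blast)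
qed

section \<open>Matrices of twisted equivariant operators\<close>

text \<open>
  The basis vectors of \<open>F[B(n,d)]\<close>. The entry \<open>a(S,T)\<close> of the matrix of \<open>A\<close> is \<open>A (point_mass T) S\<close>.
\<close>

definition point_mass :: "tuple \<Rightarrow> tuple \<Rightarrow> 'a::field" where
  "point_mass T = (\<lambda>S. if S = T then 1 else 0)"

lemma point_mass_mem_FB: "T \<in> B n d \<Longrightarrow> point_mass T \<in> FB n d"
  by (auto simp: point_mass_def FB_def)

lemma sum_fun_apply: "(\<Sum>x\<in>X. g x) y = (\<Sum>x\<in>X. g x y)" for g :: "'b \<Rightarrow> 'c \<Rightarrow> 'd::comm_monoid_add"
  by (induction X rule: infinite_finite_induct) auto

lemma End_FB_matrix:
  fixes A :: "'a::field oper"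
  assumes A: "A \<in> End_FB n d" and f: "f \<in> FB n d"
  shows "A f S = (\<Sum>T\<in>B n d. f T * A (point_mass T) S)"
proof -
  have add: "A (g + h) = A g + A h" if "g \<in> FB n d" "h \<in> FB n d" for g h
    using A that by (simp add: End_FB_def)
  have sc: "A (fscale c g) = fscale c (A g)" if "g \<in> FB n d" for g c
    using A that by (simp add: End_FB_def)
  have FB: "fscale c g \<in> FB n d" if "g \<in> FB n d" for g :: "tuple \<Rightarrow> 'a" and c
    using that by (auto simp: FB_def fscale_def)
  have FBs: "(\<Sum>T\<in>X. fscale (f T) (point_mass T)) \<in> FB n d" if "X \<subseteq> B n d" for X
    using that by (auto simp: FB_def fscale_def point_mass_def sum_fun_apply intro!: sum.neutral)
  have "A (\<Sum>T\<in>X. fscale (f T) (point_mass T)) = (\<Sum>T\<in>X. fscale (f T) (A (point_mass T)))"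
    if "finite X" "X \<subseteq> B n d" for X
    using that
  proof (induction X)
    case empty
    have "A (fscale 0 f) = fscale 0 (A f)" using sc f by blast
    then show ?case by (simp add: fscale_def zero_fun_def)
  next
    case (insert T X)
    then have T: "point_mass T \<in> FB n d" using point_mass_mem_FB by blast
    have "A (fscale (f T) (point_mass T) + (\<Sum>T\<in>X. fscale (f T) (point_mass T)))
        = fscale (f T) (A (point_mass T)) + A (\<Sum>T\<in>X. fscale (f T) (point_mass T))"
      using add[OF FB[OF T] FBs] insert.prems sc[OF T] by simp
    then show ?case
      using insert.IH insert.prems by (simp only: sum.insert[OF insert.hyps]) simp
  qed
  from this[OF finite_B subset_refl] have
    "A (\<Sum>T\<in>B n d. fscale (f T) (point_mass T)) S = (\<Sum>T\<in>B n d. f T * A (point_mass T) S)"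
    by (simp add: sum_fun_apply fscale_def)
  moreover have "(\<Sum>T\<in>B n d. fscale (f T) (point_mass T)) = f"
  proof
    fix R
    have "(\<Sum>T\<in>B n d. fscale (f T) (point_mass T)) R = (\<Sum>T\<in>B n d. if R = T then f T else 0)"
      by (auto simp: sum_fun_apply fscale_def point_mass_def intro!: sum.cong)
    also have "\<dots> = f R" using f finite_B[of n d] by (auto simp: FB_def)
    finally show "(\<Sum>T\<in>B n d. fscale (f T) (point_mass T)) R = f R" .
  qed
  ultimately show ?thesis by simp
qed

lemma rho_point_mass:
  assumes "w permutes A"
  shows "\<rho> w (point_mass (act T w)) = point_mass T"
proof -
  have "act S w = act T w \<longleftrightarrow> S = T" for S
    using act_act_inv[OF assms, of S] act_act_inv[OF assms, of T] by metis
  then show ?thesis by (simp add: \<rho>_def point_mass_def)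
qed

text \<open>
  Twisted equivariance in terms of matrix entries. The point mass at \<open>T \<cdot> w\<close> is the one that \<open>\<rho>(w)\<close>
  sends to the point mass at \<open>T\<close>.
\<close>

lemma Sminus_matrix_act:
  assumes A: "A \<in> Sminus n d" and w: "w permutes {1..d}" and T: "T \<in> B n d"
  shows "A (point_mass T) S = of_int (sign w) * A (point_mass (act T w)) (act S w)"
proof -
  have "A (\<rho> w (point_mass (act T w))) = fscale (of_int (sign w)) (\<rho> w (A (point_mass (act T w))))"
    using A w point_mass_mem_FB[OF act_mem_B[OF w T]] unfolding Sminus_def by blast
  from this[unfolded rho_point_mass[OF w]] show ?thesis by (simp add: fscale_def \<rho>_def)
qed

lemma char_ne_2_imp_2_ne_0:
  assumes "CHAR('a::field) \<noteq> 2"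
  shows "(2::'a) \<noteq> 0"
proof
  assume "(2::'a) = 0"
  then have "of_nat 2 = (0::'a)" by simp
  then have d: "CHAR('a) dvd 2" by (simp only: of_nat_eq_0_iff_char_dvd)
  then have "CHAR('a) \<le> 2" by (rule dvd_imp_le) simp
  moreover have "CHAR('a) \<noteq> 0" using d by (metis dvd_0_left_iff zero_neq_numeral)
  moreover have "CHAR('a) \<noteq> 1" by simp
  ultimately show False using assms by linarith
qed

lemma Sminus_matrix_eq_0:
  fixes A :: "'a::field oper"
  assumes char: "CHAR('a) \<noteq> 2" and A: "A \<in> Sminus n d"
    and S: "S \<in> B n d" and T: "T \<in> B n d" and nonsimple: "\<Gamma> S T \<notin> N n d"
  shows "A (point_mass T) S = 0"
proof -
  obtain i j where ij: "\<not> card (S j \<inter> T i) \<le> Suc 0"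
    using nonsimple unfolding Gamma_mem_N_iff[OF S T] by (auto simp: \<Gamma>_def)
  have "finite (S j \<inter> T i)" using B_subset[OF S] by (meson finite_Int finite_atLeastAtMost finite_subset)
  with ij obtain a b where ab: "a \<in> S j \<inter> T i" "b \<in> S j \<inter> T i" "a \<noteq> b"
    by (auto simp: card_le_Suc0_iff_eq)
  \<comment> \<open>\<open>a\<close> and \<open>b\<close> label parallel edges, so exchanging them changes neither \<open>S\<close> nor \<open>T\<close>.\<close>
  let ?w = "Transposition.transpose a b"
  have d: "a \<in> {1..d}" "b \<in> {1..d}" using ab B_subset[OF S] by blast+
  have w: "?w permutes {1..d}" by (rule permutes_swap_id[OF d])
  have fixed: "act R ?w = R" if R: "R \<in> B n d" and m: "a \<in> R k" "b \<in> R k" for R k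
  proof
    fix m
    have "a \<in> R m \<longleftrightarrow> b \<in> R m"
      using B_ex1(1)[OF R d(1)] B_ex1(1)[OF R d(2)] that by blast
    then show "act R ?w m = R m" unfolding act_def by simp
  qed
  have "act S ?w = S" "act T ?w = T"
    using ab fixed[OF S, of j] fixed[OF T, of i] by blast+
  then have "A (point_mass T) S = - A (point_mass T) S"
    using Sminus_matrix_act[OF A w T, of S] ab(3) by (simp add: sign_swap_id)
  then have "2 * A (point_mass T) S = 0" by (simp only: mult_2 eq_neg_iff_add_eq_0)
  then show ?thesis using char_ne_2_imp_2_ne_0[OF char] by simp
qed

lemma Sminus_matrix_eq_std:
  assumes "A \<in> Sminus n d" "S \<in> B n d" "T \<in> B n d" "\<Gamma> S T \<in> N n d"
  shows "A (point_mass T) S =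
    of_int (\<epsilon> d (\<Gamma> S T) (lab S T)) * A (point_mass (std_T d (\<Gamma> S T))) (std_S d (\<Gamma> S T))"
  unfolding eps_eq_sign act_label_perm[OF assms(2-4), symmetric]
  by (rule Sminus_matrix_act[OF assms(1) label_perm_permutes[OF assms(4) labelling_lab[OF assms(2,3)]] assms(3)])

section \<open>The operators \<open>\<zeta>\<close> and the basis property\<close>

text \<open>
  The condition on the graph moves from the index set into the summand, so that the sum ranges over
  all of \<open>B(n,d)\<close> and can be reindexed by the action.
\<close>

lemma zeta_apply:
  assumes "f \<in> FB n d" "S \<in> B n d"
  shows "\<zeta> n d G f S = (\<Sum>T\<in>B n d. if \<Gamma> S T = G then of_int (\<epsilon> d G (lab S T)) * f T else 0)"
proof -
  have "\<zeta> n d G f S = (\<Sum>T\<in>{T \<in> B n d. \<Gamma> S T = G}. of_int (\<epsilon> d G (lab S T)) * f T)"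
    unfolding \<zeta>_def using assms by simp
  also have "\<dots> = (\<Sum>T\<in>B n d. if \<Gamma> S T = G then of_int (\<epsilon> d G (lab S T)) * f T else 0)"
    by (rule sum.inter_filter[OF finite_B])
  finally show ?thesis .
qed

lemma zeta_mem_End_FB: "\<zeta> n d G \<in> (End_FB n d :: 'a::field oper set)"
proof -
  have add: "\<zeta> n d G (f + g) = \<zeta> n d G f + \<zeta> n d G g" if "f \<in> FB n d" "g \<in> FB n d"
    for f g :: "tuple \<Rightarrow> 'a"
  proof
    fix S
    have "f + g \<in> FB n d" using that by (simp add: FB_def)
    then show "\<zeta> n d G (f + g) S = (\<zeta> n d G f + \<zeta> n d G g) S"
      using that by (simp add: \<zeta>_def sum.distrib distrib_left)
  qed
  have scale: "\<zeta> n d G (fscale c f) = fscale c (\<zeta> n d G f)" if "f \<in> FB n d"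
    for f :: "tuple \<Rightarrow> 'a" and c
  proof
    fix S
    have "fscale c f \<in> FB n d" using that by (simp add: FB_def fscale_def)
    then show "\<zeta> n d G (fscale c f) S = fscale c (\<zeta> n d G f) S"
      using that by (simp add: \<zeta>_def fscale_def sum_distrib_left mult.left_commute)
  qed
  have "\<zeta> n d G f \<in> FB n d" "f \<notin> FB n d \<Longrightarrow> \<zeta> n d G f = 0" for f :: "tuple \<Rightarrow> 'a"
    by (simp add: \<zeta>_def FB_def) (simp add: \<zeta>_def zero_fun_def)
  then show ?thesis by (simp add: End_FB_def add scale)
qed

lemma zeta_mem_Sminus:
  assumes G: "G \<in> N n d"
  shows "\<zeta> n d G \<in> (Sminus n d :: 'a::field oper set)"
proof -
  have "\<zeta> n d G (\<rho> w f) S = of_int (sign w) * \<zeta> n d G f (act S w)"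
    if w: "w permutes {1..d}" and f: "f \<in> FB n d" for w S and f :: "tuple \<Rightarrow> 'a"
  proof (cases "S \<in> B n d")
    case False
    then show ?thesis by (simp add: \<zeta>_def act_mem_B_iff[OF w])
  next
    case S: True
    have rf: "\<rho> w f \<in> FB n d" using f by (auto simp: FB_def \<rho>_def act_mem_B_iff[OF w])
    have sw: "of_int (sign w) * (of_int (sign w) * x) = x" for x :: 'a
      by (cases w rule: sign_cases) simp_all
    let ?g = "\<lambda>T. if \<Gamma> (act S w) T = G then of_int (\<epsilon> d G (lab (act S w) T)) * f T else 0"
    have "\<zeta> n d G f (act S w) = (\<Sum>T\<in>B n d. ?g T)"
      by (rule zeta_apply[OF f act_mem_B[OF w S]])
    also have "\<dots> = (\<Sum>T\<in>B n d. ?g (act T w))"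
      by (rule sum.reindex_bij_betw[OF bij_betw_act[OF w], symmetric])
    finally have "of_int (sign w) * \<zeta> n d G f (act S w)
        = (\<Sum>T\<in>B n d. of_int (sign w) * ?g (act T w))"
      by (simp add: sum_distrib_left)
    also have "\<dots> = (\<Sum>T\<in>B n d. if \<Gamma> S T = G then of_int (\<epsilon> d G (lab S T)) * \<rho> w f T else 0)"
    proof (rule sum.cong[OF refl])
      fix T assume T: "T \<in> B n d"
      show "of_int (sign w) * ?g (act T w)
          = (if \<Gamma> S T = G then of_int (\<epsilon> d G (lab S T)) * \<rho> w f T else 0)"
        using eps_lab_act[OF S T _ w] G by (auto simp: Gamma_act[OF w] \<rho>_def sw mult.assoc)
    qed
    also have "\<dots> = \<zeta> n d G (\<rho> w f) S" by (rule zeta_apply[OF rf S, symmetric])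
    finally show ?thesis ..
  qed
  then show ?thesis
    unfolding Sminus_def using zeta_mem_End_FB
    by (auto simp: fun_eq_iff fscale_def \<rho>_def)
qed

lemma zeta_point_mass:
  assumes "S \<in> B n d" "T \<in> B n d"
  shows "\<zeta> n d G (point_mass T) S = (if \<Gamma> S T = G then of_int (\<epsilon> d G (lab S T)) else 0)"
proof -
  have "\<zeta> n d G (point_mass T) S
      = (\<Sum>R\<in>B n d. if R = T then (if \<Gamma> S T = G then of_int (\<epsilon> d G (lab S T)) else 0) else 0)"
    unfolding zeta_apply[OF point_mass_mem_FB[OF assms(2)] assms(1)]
    by (rule sum.cong) (auto simp: point_mass_def)
  then show ?thesis using assms finite_B[of n d] by simp
qed

text \<open>
  The entries at the standard pairs are dual to the family \<open>\<zeta>\<^sub>G\<close>.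
\<close>

lemma zeta_std:
  assumes "G \<in> N n d" "H \<in> N n d"
  shows "\<zeta> n d G (point_mass (std_T d H)) (std_S d H) = (if G = H then 1 else 0)"
  using assms by (simp add: zeta_point_mass[OF std_pair_mem_B[OF assms(2)]] Gamma_std eps_std)

lemma inj_on_zeta: "inj_on (\<zeta> n d :: multigraph \<Rightarrow> 'a::field oper) (N n d)"
proof (rule inj_onI)
  fix G H assume *: "G \<in> N n d" "H \<in> N n d" "\<zeta> n d G = (\<zeta> n d H :: 'a oper)"
  have "(if G = H then 1 else 0) = (1::'a)"
    using zeta_std[OF *(1,2), where ?'a = 'a] zeta_std[OF *(2,2), where ?'a = 'a] *(3) by simp
  then show "G = H" by (simp split: if_splits)
qed

lemma independent_zeta: "oper.independent {\<zeta> n d G :: 'a::field oper |G. G \<in> N n d}"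
proof -
  have fin: "finite (\<zeta> n d ` N n d :: 'a oper set)" by (rule finite_imageI[OF finite_N])
  have "u (\<zeta> n d H) = 0"
    if 0: "(\<Sum>v\<in>\<zeta> n d ` N n d. opscale (u v) v) = 0" and H: "H \<in> N n d"
    for u :: "'a oper \<Rightarrow> 'a" and H
  proof -
    have "0 = (\<Sum>G\<in>N n d. opscale (u (\<zeta> n d G)) (\<zeta> n d G)) (point_mass (std_T d H)) (std_S d H)"
      using 0 by (simp add: sum.reindex[OF inj_on_zeta])
    also have "\<dots> = (\<Sum>G\<in>N n d. if G = H then u (\<zeta> n d H) else 0)"
      unfolding sum_fun_apply opscale_def fscale_def
      by (rule sum.cong) (auto simp: zeta_std[OF _ H])
    also have "\<dots> = u (\<zeta> n d H)" using H finite_N[of n d] by simp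
    finally show ?thesis ..
  qed
  then have "oper.independent (\<zeta> n d ` N n d :: 'a oper set)"
    unfolding oper.dependent_finite[OF fin] by blast
  then show ?thesis by (simp add: setcompr_eq_image)
qed

lemma subspace_Sminus: "oper.subspace (Sminus n d :: 'a::field oper set)"
proof (rule oper.subspaceI)
  have FB_zero: "(0 :: tuple \<Rightarrow> 'a) \<in> FB n d" by (simp add: FB_def)
  have FB_add: "f + g \<in> FB n d" if "f \<in> FB n d" "g \<in> FB n d" for f g :: "tuple \<Rightarrow> 'a"
    using that by (simp add: FB_def)
  have FB_scale: "fscale c f \<in> FB n d" if "f \<in> FB n d" for f :: "tuple \<Rightarrow> 'a" and c
    using that by (simp add: FB_def fscale_def)
  have lin: "fscale c (f + g) = fscale c f + fscale c g" "fscale c (fscale e f) = fscale e (fscale c f)"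
    "\<rho> w (f + g) = \<rho> w f + \<rho> w g" "\<rho> w (fscale c f) = fscale c (\<rho> w f)"
    "fscale c 0 = 0" "\<rho> w 0 = 0" for f g :: "tuple \<Rightarrow> 'a" and c e w
    by (simp_all add: fun_eq_iff fscale_def \<rho>_def distrib_left mult.left_commute)
  show "0 \<in> (Sminus n d :: 'a oper set)"
    by (simp add: Sminus_def End_FB_def lin FB_zero)
  show "A + A' \<in> Sminus n d" if "A \<in> Sminus n d" "A' \<in> Sminus n d" for A A' :: "'a oper"
    using that by (simp add: Sminus_def End_FB_def lin FB_add add_ac)
  show "opscale c A \<in> Sminus n d" if "A \<in> Sminus n d" for c and A :: "'a oper"
    using that unfolding Sminus_def End_FB_def opscale_def
    by (simp add: lin FB_scale)
qed

lemma Sminus_expansion: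
  fixes A :: "'a::field oper"
  assumes char: "CHAR('a) \<noteq> 2" and A: "A \<in> Sminus n d"
  shows "A = (\<Sum>G\<in>N n d. opscale (A (point_mass (std_T d G)) (std_S d G)) (\<zeta> n d G))"
proof (intro ext)
  fix f :: "tuple \<Rightarrow> 'a" and S
  let ?c = "\<lambda>G. A (point_mass (std_T d G)) (std_S d G)"
  have E: "A \<in> End_FB n d" using A by (simp add: Sminus_def)
  have R: "(\<Sum>G\<in>N n d. opscale (?c G) (\<zeta> n d G)) f S = (\<Sum>G\<in>N n d. ?c G * \<zeta> n d G f S)"
    by (simp add: sum_fun_apply opscale_def fscale_def)
  show "A f S = (\<Sum>G\<in>N n d. opscale (?c G) (\<zeta> n d G)) f S"
  proof (cases "f \<in> FB n d \<and> S \<in> B n d")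
    case False
    then have "A f S = 0" using E by (cases "f \<in> FB n d") (auto simp: End_FB_def FB_def)
    moreover have "\<zeta> n d G f S = 0" for G using False by (auto simp: \<zeta>_def)
    ultimately show ?thesis by (simp add: R)
  next
    case True
    then have f: "f \<in> FB n d" and S: "S \<in> B n d" by auto
    have entry: "A (point_mass T) S = (\<Sum>G\<in>N n d. ?c G * \<zeta> n d G (point_mass T) S)"
      if T: "T \<in> B n d" for T
    proof -
      have "(\<Sum>G\<in>N n d. ?c G * \<zeta> n d G (point_mass T) S)
          = (\<Sum>G\<in>N n d. if \<Gamma> S T = G then ?c G * of_int (\<epsilon> d G (lab S T)) else 0)"
        by (rule sum.cong) (auto simp: zeta_point_mass[OF S T])
      also have "\<dots> = (if \<Gamma> S T \<in> N n d
          then ?c (\<Gamma> S T) * of_int (\<epsilon> d (\<Gamma> S T) (lab S T)) else 0)"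
        by (simp add: finite_N)
      also have "\<dots> = A (point_mass T) S"
        using Sminus_matrix_eq_0[OF char A S T] Sminus_matrix_eq_std[OF A S T]
        by (simp add: mult.commute)
      finally show ?thesis ..
    qed
    have "A f S = (\<Sum>T\<in>B n d. f T * (\<Sum>G\<in>N n d. ?c G * \<zeta> n d G (point_mass T) S))"
      unfolding End_FB_matrix[OF E f, of S] by (rule sum.cong) (simp_all add: entry)
    also have "\<dots> = (\<Sum>T\<in>B n d. \<Sum>G\<in>N n d. ?c G * (f T * \<zeta> n d G (point_mass T) S))"
      by (simp add: sum_distrib_left mult.left_commute)
    also have "\<dots> = (\<Sum>G\<in>N n d. \<Sum>T\<in>B n d. ?c G * (f T * \<zeta> n d G (point_mass T) S))"
      by (rule sum.swap)
    also have "\<dots> = (\<Sum>G\<in>N n d. ?c G * \<zeta> n d G f S)"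
      by (simp add: sum_distrib_left[symmetric] End_FB_matrix[OF zeta_mem_End_FB f, symmetric])
    finally show ?thesis by (simp add: R)
  qed
qed

theorem theorem2p24:
  fixes n d :: nat
  assumes "CHAR('a::field) \<noteq> 2" and "n \<ge> 1" and "d \<ge> 1"
  shows "inj_on (\<zeta> n d :: multigraph \<Rightarrow> 'a oper) (N n d)
    \<and> oper.independent {\<zeta> n d G :: 'a oper |G. G \<in> N n d}
    \<and> oper.span {\<zeta> n d G :: 'a oper |G. G \<in> N n d} = Sminus n d"
proof (intro conjI inj_on_zeta independent_zeta)
  show "oper.span {\<zeta> n d G :: 'a oper |G. G \<in> N n d} = Sminus n d"
  proof (rule oper.span_unique)
    show "{\<zeta> n d G :: 'a oper |G. G \<in> N n d} \<subseteq> Sminus n d" using zeta_mem_Sminus by blast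
    show "oper.subspace (Sminus n d :: 'a oper set)" by (rule subspace_Sminus)
    fix V :: "'a oper set"
    assume V: "{\<zeta> n d G |G. G \<in> N n d} \<subseteq> V" "oper.subspace V"
    show "Sminus n d \<subseteq> V"
    proof
      fix A :: "'a oper" assume A: "A \<in> Sminus n d"
      have "(\<Sum>G\<in>N n d. opscale (A (point_mass (std_T d G)) (std_S d G)) (\<zeta> n d G)) \<in> V"
        by (intro oper.subspace_sum[OF V(2)] oper.subspace_scale[OF V(2)]) (use V(1) in blast)
      then show "A \<in> V" using Sminus_expansion[OF assms(1) A] by simp
    qed
  qed
qed

end
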